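(* Let $\Gamma$ be a countable discrete amenable residually finite group with identity $e$, and let $(\Delta_n)_{n\in\mathbb{N}}$ be a sequence of finite-index normal subgroups of $\Gamma$ such that $\bigcap_m\bigcup_{n\ge m}\Delta_n=\{e\}$. For each $n$ let $\pi_{\Gamma/\Delta_n}\colon\mathbb{R}\Gamma\to\mathbb{R}(\Gamma/\Delta_n)$ be the ring homomorphism induced by the quotient map $\Gamma\to\Gamma/\Delta_n$. Then for every $f\in\mathbb{R}_{\ge0}\Gamma$, $$\mathrm{per}(f)\ge\limsup_{n\to\infty}\mathrm{per}(\pi_{\Gamma/\Delta_n}(f)).$$
   Context: For a discrete group $G$, $\mathscr{F}(G)$ is the collection of nonempty finite subsets of $G$; $\mathbb{R}G$ is the real group ring (finitely supported functions $f\colon s\mapsto f_s$) and $\mathbb{R}_{\ge0}G$ its subset of nonnegative functions. For $\mathsf{A},F\in\mathscr{F}(G)$ and $x\in\mathsf{A}^F$ let $\varphi^{(x)}\colon F\to G$, $\varphi^{(x)}(s)=sx_s$, and let $X_{\mathsf{A},F}$ be the set of $x\in\mathsf{A}^F$ such that $\varphi^{(x)}$ is injective and $\varphi^{(x)}(F)\supseteq\{s\in G:s\mathsf{A}^{-1}\subseteq F\}$. Permanent: if $G$ is countable amenable and $f\in\mathbb{R}_{\ge0}G$, then $\mathrm{per}(f)=\lim_F\frac1{|F|}\log\bigl(\sum_{x\in X_{\mathsf{A},F}}\prod_{s\in F}f_{x_s}\bigr)\in[-\infty,+\infty)$, where $\mathsf{A}\in\mathscr{F}(G)$ is any set containing the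 support of $f$ (the limit exists and is independent of $\mathsf{A}$; $\log0=-\infty$). Here $\lim_F\phi(F)=C$ means that for every neighbourhood $U$ of $C$ in $[-\infty,+\infty)$ there are $K\in\mathscr{F}(G)$ and $\delta>0$ such that $\phi(F)\in U$ for all $F\in\mathscr{F}(G)$ with $|FK\vartriangle F|<\delta|F|$. In particular, if $G$ is finite and $f\neq 0$ with support $\mathsf{A}$, then $\mathrm{per}(f)=\frac1{|G|}\log\bigl(\sum_{x\in X_{\mathsf{A}}}\prod_{s\in G}f_{x_s}\bigr)$, where $X_{\mathsf{A}}$ is the set of $x\in\mathsf{A}^G$ for which $s\mapsto sx_s$ is a bijection of $G$. *)

theory Defs
  imports "HOL-Analysis.Analysis" "HOL-Library.Poly_Mapping" "HOL-Algebra.Coset" "HOL-Algebra.Ring"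
begin

section \<open>Amenable and residually finite groups\<close>

definition nonempty_finite_subsets :: "('a, 'b) monoid_scheme \<Rightarrow> 'a set set"
  where "nonempty_finite_subsets G = {F. F \<subseteq> carrier G \<and> finite F \<and> F \<noteq> {}}"

definition folner_sets :: "('a, 'b) monoid_scheme \<Rightarrow> 'a set \<Rightarrow> real \<Rightarrow> 'a set set"
  where "folner_sets G K \<delta> =
    {F \<in> nonempty_finite_subsets G. real (card (sym_diff (F <#>\<^bsub>G\<^esub> K) F)) < \<delta> * real (card F)}"

text \<open>Amenability of a discrete group is Folner's condition, in the same right-handed form as the
  limits over \<open>F\<close> below; it says exactly that those limits run along a proper filter.\<close>

definition amenable :: "('a, 'b) monoid_scheme \<Rightarrow> bool"
  where "amenable G \<longleftrightarrow>
    (\<forall>K \<in> nonempty_finite_subsets G. \<forall>\<delta>>0. folner_sets G K \<delta> \<noteq> {})"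

definition residually_finite :: "('a, 'b) monoid_scheme \<Rightarrow> bool"
  where "residually_finite G \<longleftrightarrow>
    (\<forall>g \<in> carrier G. g \<noteq> \<one>\<^bsub>G\<^esub> \<longrightarrow> (\<exists>N. N \<lhd> G \<and> finite (carrier (G Mod N)) \<and> g \<notin> N))"

definition folner_filter :: "('a, 'b) monoid_scheme \<Rightarrow> 'a set filter"
  where "folner_filter G =
    (INF (K, \<delta>) \<in> nonempty_finite_subsets G \<times> {0<..}. principal (folner_sets G K \<delta>))"


section \<open>The real group ring\<close>

definition convolution ::
  "('a, 'b) monoid_scheme \<Rightarrow> ('a \<Rightarrow>\<^sub>0 real) \<Rightarrow> ('a \<Rightarrow>\<^sub>0 real) \<Rightarrow> ('a \<Rightarrow>\<^sub>0 real)"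
  where "convolution G f g =
    (\<Sum>s \<in> Poly_Mapping.keys f. \<Sum>t \<in> Poly_Mapping.keys g.
       Poly_Mapping.single (s \<otimes>\<^bsub>G\<^esub> t) (Poly_Mapping.lookup f s * Poly_Mapping.lookup g t))"

definition group_ring :: "('a, 'b) monoid_scheme \<Rightarrow> ('a \<Rightarrow>\<^sub>0 real) ring"
  where "group_ring G =
    \<lparr>carrier = {f. Poly_Mapping.keys f \<subseteq> carrier G}, mult = convolution G,
     one = Poly_Mapping.single \<one>\<^bsub>G\<^esub> 1, zero = 0, add = (+)\<rparr>"

definition nonneg_group_ring :: "('a, 'b) monoid_scheme \<Rightarrow> ('a \<Rightarrow>\<^sub>0 real) set"
  where "nonneg_group_ring G =
    {f \<in> carrier (group_ring G). \<forall>s \<in> carrier G. 0 \<le> Poly_Mapping.lookup f s}"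

definition pushforward :: "('a \<Rightarrow> 'c) \<Rightarrow> ('a \<Rightarrow>\<^sub>0 real) \<Rightarrow> ('c \<Rightarrow>\<^sub>0 real)"
  where "pushforward \<phi> f =
    (\<Sum>s \<in> Poly_Mapping.keys f. Poly_Mapping.single (\<phi> s) (Poly_Mapping.lookup f s))"

definition quotient_projection ::
  "('a, 'b) monoid_scheme \<Rightarrow> 'a set \<Rightarrow> ('a \<Rightarrow>\<^sub>0 real) \<Rightarrow> ('a set \<Rightarrow>\<^sub>0 real)"
  where "quotient_projection G N = pushforward (\<lambda>s. N #>\<^bsub>G\<^esub> s)"


section \<open>The permanent\<close>

definition admissible :: "('a, 'b) monoid_scheme \<Rightarrow> 'a set \<Rightarrow> 'a set \<Rightarrow> ('a \<Rightarrow> 'a) set"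
  where "admissible G A F =
    {x \<in> F \<rightarrow>\<^sub>E A. inj_on (\<lambda>s. s \<otimes>\<^bsub>G\<^esub> x s) F \<and>
       {s \<in> carrier G. s <#\<^bsub>G\<^esub> (set_inv\<^bsub>G\<^esub> A) \<subseteq> F} \<subseteq> (\<lambda>s. s \<otimes>\<^bsub>G\<^esub> x s) ` F}"

definition log_ereal :: "real \<Rightarrow> ereal"
  where "log_ereal r = (if r = 0 then -\<infinity> else ereal (ln r))"

definition local_permanent ::
  "('a, 'b) monoid_scheme \<Rightarrow> ('a \<Rightarrow>\<^sub>0 real) \<Rightarrow> 'a set \<Rightarrow> 'a set \<Rightarrow> ereal"
  where "local_permanent G f A F =
    ereal (1 / real (card F)) *
      log_ereal (\<Sum>x \<in> admissible G A F. \<Prod>s \<in> F. Poly_Mapping.lookup f (x s))"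

text \<open>The quantifier over \<open>A\<close> expresses that the limit does not depend on the finite set \<open>A\<close>
  containing the support of \<open>f\<close>.\<close>

definition per :: "('a, 'b) monoid_scheme \<Rightarrow> ('a \<Rightarrow>\<^sub>0 real) \<Rightarrow> ereal"
  where "per G f =
    (THE L. \<forall>A \<in> nonempty_finite_subsets G. Poly_Mapping.keys f \<subseteq> A \<longrightarrow>
       (local_permanent G f A \<longlongrightarrow> L) (folner_filter G))"


section \<open>Basic facts\<close>

lemma lookup_pushforward:
  "Poly_Mapping.lookup (pushforward \<phi> f) t =
     (\<Sum>s \<in> {s \<in> Poly_Mapping.keys f. \<phi> s = t}. Poly_Mapping.lookup f s)"
  by (simp add: pushforward_def lookup_sum lookup_single when_def sum.If_cases Int_def)

lemma pushforward_eq: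
  assumes "finite S" "Poly_Mapping.keys f \<subseteq> S"
  shows "pushforward \<phi> f = (\<Sum>s\<in>S. Poly_Mapping.single (\<phi> s) (Poly_Mapping.lookup f s))"
  unfolding pushforward_def
  by (rule sum.mono_neutral_left) (use assms in \<open>auto simp: in_keys_iff\<close>)

lemma pushforward_zero: "pushforward \<phi> 0 = 0"
  by (simp add: pushforward_def)

lemma pushforward_single: "pushforward \<phi> (Poly_Mapping.single s c) = Poly_Mapping.single (\<phi> s) c"
  by (simp add: pushforward_def)

lemma pushforward_add: "pushforward \<phi> (f + g) = pushforward \<phi> f + pushforward \<phi> g"
proof -
  let ?S = "Poly_Mapping.keys f \<union> Poly_Mapping.keys g"
  have "Poly_Mapping.keys (f + g) \<subseteq> ?S" by (rule keys_add)
  then show ?thesis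
    by (simp add: pushforward_eq[of ?S] lookup_add single_add sum.distrib)
qed

lemma pushforward_sum: "pushforward \<phi> (sum h I) = (\<Sum>i\<in>I. pushforward \<phi> (h i))"
  by (induction I rule: infinite_finite_induct) (simp_all add: pushforward_zero pushforward_add)

lemma convolution_eq:
  assumes "finite S" "Poly_Mapping.keys f \<subseteq> S" "finite T" "Poly_Mapping.keys g \<subseteq> T"
  shows "convolution G f g = (\<Sum>s\<in>S. \<Sum>t\<in>T.
    Poly_Mapping.single (s \<otimes>\<^bsub>G\<^esub> t) (Poly_Mapping.lookup f s * Poly_Mapping.lookup g t))"
proof -
  have "convolution G f g = (\<Sum>s\<in>Poly_Mapping.keys f. \<Sum>t\<in>T.
    Poly_Mapping.single (s \<otimes>\<^bsub>G\<^esub> t) (Poly_Mapping.lookup f s * Poly_Mapping.lookup g t))"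
    unfolding convolution_def
    by (intro sum.cong refl sum.mono_neutral_left) (use assms in \<open>auto simp: in_keys_iff\<close>)
  also have "\<dots> = (\<Sum>s\<in>S. \<Sum>t\<in>T.
    Poly_Mapping.single (s \<otimes>\<^bsub>G\<^esub> t) (Poly_Mapping.lookup f s * Poly_Mapping.lookup g t))"
    by (rule sum.mono_neutral_left) (use assms in \<open>auto simp: in_keys_iff\<close>)
  finally show ?thesis .
qed

lemma convolution_single:
  "convolution G (Poly_Mapping.single s c) (Poly_Mapping.single t d) =
     Poly_Mapping.single (s \<otimes>\<^bsub>G\<^esub> t) (c * d)"
  by (subst convolution_eq[of "{s}" _ "{t}"]) auto

lemma convolution_add_left: "convolution G (f + g) h = convolution G f h + convolution G g h"
proof -
  let ?S = "Poly_Mapping.keys f \<union> Poly_Mapping.keys g"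
  have "Poly_Mapping.keys (f + g) \<subseteq> ?S" by (rule keys_add)
  then show ?thesis
    by (simp add: convolution_eq[of ?S _ "Poly_Mapping.keys h"] lookup_add distrib_right
        single_add sum.distrib)
qed

lemma convolution_add_right: "convolution G h (f + g) = convolution G h f + convolution G h g"
proof -
  let ?S = "Poly_Mapping.keys f \<union> Poly_Mapping.keys g"
  have "Poly_Mapping.keys (f + g) \<subseteq> ?S" by (rule keys_add)
  then show ?thesis
    by (simp add: convolution_eq[of "Poly_Mapping.keys h" _ ?S] lookup_add distrib_left
        single_add sum.distrib)
qed

lemma convolution_sum_left:
  "finite I \<Longrightarrow> convolution G (sum f I) h = (\<Sum>i\<in>I. convolution G (f i) h)"
  by (induction I rule: finite_induct) (simp_all add: convolution_add_left, simp add: convolution_def)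

lemma convolution_sum_right:
  "finite I \<Longrightarrow> convolution G h (sum f I) = (\<Sum>i\<in>I. convolution G h (f i))"
  by (induction I rule: finite_induct) (simp_all add: convolution_add_right, simp add: convolution_def)

lemma pushforward_ring_hom:
  assumes "group G" "group H" "\<phi> \<in> hom G H"
  shows "pushforward \<phi> \<in> ring_hom (group_ring G) (group_ring H)"
proof (rule ring_hom_memI)
  fix f assume f: "f \<in> carrier (group_ring G)"
  have "Poly_Mapping.keys (pushforward \<phi> f) \<subseteq> \<phi> ` Poly_Mapping.keys f"
    unfolding pushforward_def by (rule order_trans[OF keys_sum]) auto
  with f show "pushforward \<phi> f \<in> carrier (group_ring H)"
    using assms(3) by (fastforce simp: group_ring_def hom_def)
next
  fix f g assume fg: "f \<in> carrier (group_ring G)" "g \<in> carrier (group_ring G)"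
  show "pushforward \<phi> (f \<oplus>\<^bsub>group_ring G\<^esub> g) = pushforward \<phi> f \<oplus>\<^bsub>group_ring H\<^esub> pushforward \<phi> g"
    by (simp add: group_ring_def pushforward_add)
  have "pushforward \<phi> (convolution G f g) =
      (\<Sum>s \<in> Poly_Mapping.keys f. \<Sum>t \<in> Poly_Mapping.keys g.
         Poly_Mapping.single (\<phi> (s \<otimes>\<^bsub>G\<^esub> t)) (Poly_Mapping.lookup f s * Poly_Mapping.lookup g t))"
    by (simp add: convolution_def pushforward_sum pushforward_single)
  also have "\<dots> = (\<Sum>s \<in> Poly_Mapping.keys f. \<Sum>t \<in> Poly_Mapping.keys g.
         Poly_Mapping.single (\<phi> s \<otimes>\<^bsub>H\<^esub> \<phi> t) (Poly_Mapping.lookup f s * Poly_Mapping.lookup g t))"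
    using fg assms(3) by (intro sum.cong refl) (auto simp: group_ring_def hom_def subset_iff)
  also have "\<dots> = convolution H (pushforward \<phi> f) (pushforward \<phi> g)"
    by (simp add: pushforward_def convolution_sum_left convolution_sum_right convolution_single
        sum.swap[of _ "Poly_Mapping.keys g"])
  finally show "pushforward \<phi> (f \<otimes>\<^bsub>group_ring G\<^esub> g) =
      pushforward \<phi> f \<otimes>\<^bsub>group_ring H\<^esub> pushforward \<phi> g"
    by (simp add: group_ring_def)
next
  show "pushforward \<phi> \<one>\<^bsub>group_ring G\<^esub> = \<one>\<^bsub>group_ring H\<^esub>"
    using assms by (simp add: group_ring_def pushforward_single hom_one)
qed

lemma quotient_projection_ring_hom:
  assumes "N \<lhd> G"
  shows "quotient_projection G N \<in> ring_hom (group_ring G) (group_ring (G Mod N))"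
  unfolding quotient_projection_def
  using assms normal.axioms(2)[OF assms] normal.factorgroup_is_group[OF assms]
    normal.r_coset_hom_Mod[OF assms]
  by (simp add: pushforward_ring_hom)

lemma card_sym_diff_set_mult_mono:
  assumes "group G" "F \<subseteq> carrier G" "finite F" "K \<noteq> {}" "K \<subseteq> L" "L \<subseteq> carrier G" "finite L"
  shows "card (sym_diff (F <#>\<^bsub>G\<^esub> K) F) \<le> 2 * card (sym_diff (F <#>\<^bsub>G\<^esub> L) F)"
proof -
  interpret group G by fact
  obtain k where k: "k \<in> K" using assms by blast
  with assms have kG: "k \<in> carrier G" by blast
  let ?Fk = "(\<lambda>s. s \<otimes>\<^bsub>G\<^esub> k) ` F"
  have fin: "finite (F <#>\<^bsub>G\<^esub> L)" using assms by (auto simp: set_mult_def)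
  have "inj_on (\<lambda>s. s \<otimes>\<^bsub>G\<^esub> k) F" by (rule inj_onI) (meson assms(2) kG right_cancel subsetD)
  then have card: "card ?Fk = card F" by (rule card_image)
  have "card (F - ?Fk) = card F - card (F \<inter> ?Fk)"
    by (rule card_Diff_subset_Int) (use assms in auto)
  also have "\<dots> = card (?Fk - F)"
    using card card_Diff_subset_Int[of ?Fk F] assms by (simp add: Int_commute)
  finally have eq: "card (F - ?Fk) = card (?Fk - F)" .
  have FkK: "?Fk \<subseteq> F <#>\<^bsub>G\<^esub> K" using k by (auto simp: set_mult_def)
  have KL: "F <#>\<^bsub>G\<^esub> K \<subseteq> F <#>\<^bsub>G\<^esub> L" using assms(5) by (auto simp: set_mult_def)
  have "card (F - (F <#>\<^bsub>G\<^esub> K)) \<le> card (F - ?Fk)"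
    by (rule card_mono) (use assms FkK in auto)
  also have "\<dots> \<le> card (sym_diff (F <#>\<^bsub>G\<^esub> L) F)"
    unfolding eq by (rule card_mono) (use assms FkK KL fin in auto)
  finally have 1: "card (F - (F <#>\<^bsub>G\<^esub> K)) \<le> card (sym_diff (F <#>\<^bsub>G\<^esub> L) F)" .
  have 2: "card ((F <#>\<^bsub>G\<^esub> K) - F) \<le> card (sym_diff (F <#>\<^bsub>G\<^esub> L) F)"
    by (rule card_mono) (use assms KL fin in auto)
  have "card (sym_diff (F <#>\<^bsub>G\<^esub> K) F) \<le> card ((F <#>\<^bsub>G\<^esub> K) - F) + card (F - (F <#>\<^bsub>G\<^esub> K))"
    by (rule card_Un_le)
  with 1 2 show ?thesis by linarith
qed

lemma folner_sets_mono:
  assumes "group G" "K \<noteq> {}" "K \<subseteq> L" "L \<in> nonempty_finite_subsets G" "\<epsilon> \<le> \<delta> / 2"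
  shows "folner_sets G L \<epsilon> \<subseteq> folner_sets G K \<delta>"
proof
  fix F assume F: "F \<in> folner_sets G L \<epsilon>"
  then have F': "F \<subseteq> carrier G" "finite F"
    by (auto simp: folner_sets_def nonempty_finite_subsets_def)
  have "real (card (sym_diff (F <#>\<^bsub>G\<^esub> K) F)) \<le> 2 * real (card (sym_diff (F <#>\<^bsub>G\<^esub> L) F))"
    using card_sym_diff_set_mult_mono[of G F K L] assms F'
    unfolding nonempty_finite_subsets_def by fastforce
  also have "\<dots> < 2 * (\<epsilon> * real (card F))"
    using F by (simp add: folner_sets_def)
  also have "\<dots> \<le> \<delta> * real (card F)"
    using mult_right_mono[of "2 * \<epsilon>" \<delta> "real (card F)"] assms(5) by simp
  finally show "F \<in> folner_sets G K \<delta>" using F by (simp add: folner_sets_def)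
qed

lemma eventually_folner_filter:
  assumes "group G"
  shows "eventually P (folner_filter G) \<longleftrightarrow>
    (\<exists>K \<in> nonempty_finite_subsets G. \<exists>\<delta>>0. \<forall>F \<in> folner_sets G K \<delta>. P F)"
proof -
  interpret group G by fact
  let ?B = "nonempty_finite_subsets G \<times> {0::real<..}"
  have ne: "?B \<noteq> {}"
  proof -
    have "({\<one>\<^bsub>G\<^esub>}, 1) \<in> ?B" by (simp add: nonempty_finite_subsets_def)
    then show ?thesis by blast
  qed
  have dir: "\<exists>c\<in>?B. (case c of (K, \<delta>) \<Rightarrow> principal (folner_sets G K \<delta>)) \<le>
      inf (case a of (K, \<delta>) \<Rightarrow> principal (folner_sets G K \<delta>))
          (case b of (K, \<delta>) \<Rightarrow> principal (folner_sets G K \<delta>))"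
    if "a \<in> ?B" "b \<in> ?B" for a b
  proof -
    obtain K \<delta> L \<epsilon> where ab: "a = (K, \<delta>)" "b = (L, \<epsilon>)" by (cases a, cases b) auto
    have U: "K \<union> L \<in> nonempty_finite_subsets G" "K \<noteq> {}" "L \<noteq> {}" "0 < \<delta>" "0 < \<epsilon>"
      using that ab by (auto simp: nonempty_finite_subsets_def)
    have "folner_sets G (K \<union> L) (min \<delta> \<epsilon> / 2) \<subseteq> folner_sets G K \<delta> \<inter> folner_sets G L \<epsilon>"
      by (intro Int_greatest folner_sets_mono assms U) (auto simp: U)
    with U ab show ?thesis
      by (intro bexI[of _ "(K \<union> L, min \<delta> \<epsilon> / 2)"]) auto
  qed
  have "eventually P (folner_filter G) \<longleftrightarrow>
      (\<exists>b\<in>?B. eventually P (case b of (K, \<delta>) \<Rightarrow> principal (folner_sets G K \<delta>)))"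
    unfolding folner_filter_def by (rule eventually_INF_base[OF ne dir])
  then show ?thesis by (auto simp: eventually_principal Bex_def)
qed

lemma folner_filter_neq_bot_iff:
  assumes "group G"
  shows "folner_filter G \<noteq> bot \<longleftrightarrow> amenable G"
  using eventually_folner_filter[OF assms, of "\<lambda>_. False"]
  by (auto simp: trivial_limit_def amenable_def)

lemma folner_filter_finite:
  assumes "group G" "finite (carrier G)"
  shows "folner_filter G = principal {carrier G}"
proof -
  interpret group G by fact
  have card: "card (carrier G) > 0" using assms by (auto simp: card_gt_0_iff)
  have c: "carrier G \<in> nonempty_finite_subsets G"
    using assms by (auto simp: nonempty_finite_subsets_def)
  have full: "F <#>\<^bsub>G\<^esub> K = carrier G"
    if FK: "F \<subseteq> carrier G" "K \<subseteq> carrier G" "F \<noteq> {}" "K \<noteq> {}" "F = carrier G \<or> K = carrier G" for F K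
  proof
    show "F <#>\<^bsub>G\<^esub> K \<subseteq> carrier G" using that by (simp add: set_mult_closed)
    show "carrier G \<subseteq> F <#>\<^bsub>G\<^esub> K"
    proof
      fix g assume g: "g \<in> carrier G"
      obtain a b where ab: "a \<in> F" "b \<in> K" using FK by blast
      then have abG: "a \<in> carrier G" "b \<in> carrier G" using FK by auto
      have "g = a \<otimes>\<^bsub>G\<^esub> (inv\<^bsub>G\<^esub> a \<otimes>\<^bsub>G\<^esub> g)" "g = (g \<otimes>\<^bsub>G\<^esub> inv\<^bsub>G\<^esub> b) \<otimes>\<^bsub>G\<^esub> b"
        using g abG by (simp_all add: m_assoc[of g] m_assoc[symmetric, of a])
      moreover have "inv\<^bsub>G\<^esub> a \<otimes>\<^bsub>G\<^esub> g \<in> carrier G" "g \<otimes>\<^bsub>G\<^esub> inv\<^bsub>G\<^esub> b \<in> carrier G"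
        using g abG by auto
      ultimately show "g \<in> F <#>\<^bsub>G\<^esub> K" using FK(5) ab unfolding set_mult_def by blast
    qed
  qed
  have mem: "carrier G \<in> folner_sets G K \<delta>" if "K \<in> nonempty_finite_subsets G" "\<delta> > 0" for K \<delta>
    using that c card full[of "carrier G" K]
    by (auto simp: folner_sets_def nonempty_finite_subsets_def)
  have "F = carrier G" if "F \<in> folner_sets G (carrier G) (1 / card (carrier G))" for F
  proof (rule ccontr)
    assume "F \<noteq> carrier G"
    moreover have F: "F \<subseteq> carrier G" "F \<noteq> {}" "finite F"
      using that by (auto simp: folner_sets_def nonempty_finite_subsets_def)
    ultimately have "carrier G - F \<noteq> {}" by blast
    then have "1 \<le> card (carrier G - F)" using assms by (simp add: Suc_le_eq card_gt_0_iff)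
    moreover have "F - carrier G = {}" using F by blast
    moreover have "F <#>\<^bsub>G\<^esub> carrier G = carrier G" using full[of F "carrier G"] F by auto
    ultimately have "1 \<le> real (card (sym_diff (F <#>\<^bsub>G\<^esub> carrier G) F))"
      by (metis of_nat_1 of_nat_le_iff sup_bot.right_neutral)
    also have "\<dots> < real (card F) / real (card (carrier G))"
      using that by (simp add: folner_sets_def)
    also have "\<dots> \<le> 1" using card_mono[of "carrier G" F] F assms card by simp
    finally show False by simp
  qed
  then have "folner_sets G (carrier G) (1 / card (carrier G)) = {carrier G}"
    using mem[OF c] card by auto
  moreover have "0 < 1 / real (card (carrier G))" using card by simp
  ultimately have "eventually P (folner_filter G) \<longleftrightarrow> P (carrier G)" for P
    unfolding eventually_folner_filter[OF assms(1)] using mem c by (metis singletonD)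
  then show ?thesis by (intro filter_eqI) (simp add: eventually_principal)
qed

lemma per_finite:
  assumes "group G" "finite (carrier G)" "f \<in> carrier (group_ring G)" "f \<noteq> 0"
  shows "per G f = ereal (1 / real (card (carrier G))) * log_ereal
    (\<Sum>x \<in> {x \<in> carrier G \<rightarrow>\<^sub>E Poly_Mapping.keys f. bij_betw (\<lambda>s. s \<otimes>\<^bsub>G\<^esub> x s) (carrier G) (carrier G)}.
       \<Prod>s \<in> carrier G. Poly_Mapping.lookup f (x s))" (is "_ = ?R")
proof -
  interpret group G by fact
  have keys: "Poly_Mapping.keys f \<in> nonempty_finite_subsets G"
    using assms by (auto simp: nonempty_finite_subsets_def group_ring_def)
  have adm: "admissible G A (carrier G) =
      {x \<in> carrier G \<rightarrow>\<^sub>E A. bij_betw (\<lambda>s. s \<otimes>\<^bsub>G\<^esub> x s) (carrier G) (carrier G)}"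
    if "A \<in> nonempty_finite_subsets G" for A
  proof -
    have A: "A \<subseteq> carrier G" using that by (simp add: nonempty_finite_subsets_def)
    have "{s \<in> carrier G. s <#\<^bsub>G\<^esub> (set_inv\<^bsub>G\<^esub> A) \<subseteq> carrier G} = carrier G"
      using A by (auto simp: l_coset_def SET_INV_def)
    moreover have "(\<lambda>s. s \<otimes>\<^bsub>G\<^esub> x s) ` carrier G \<subseteq> carrier G" if "x \<in> carrier G \<rightarrow>\<^sub>E A" for x
      using that A by (auto simp: PiE_def Pi_def subset_iff)
    ultimately show ?thesis unfolding admissible_def bij_betw_def by auto
  qed
  have R: "local_permanent G f A (carrier G) = ?R"
    if A: "A \<in> nonempty_finite_subsets G" "Poly_Mapping.keys f \<subseteq> A" for A
  proof -
    have "(\<Sum>x \<in> admissible G A (carrier G). \<Prod>s \<in> carrier G. Poly_Mapping.lookup f (x s)) =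
        (\<Sum>x \<in> admissible G (Poly_Mapping.keys f) (carrier G). \<Prod>s \<in> carrier G. Poly_Mapping.lookup f (x s))"
    proof (rule sum.mono_neutral_right)
      show "finite (admissible G A (carrier G))"
        using A assms(2) by (auto simp: admissible_def nonempty_finite_subsets_def finite_PiE)
      show "admissible G (Poly_Mapping.keys f) (carrier G) \<subseteq> admissible G A (carrier G)"
        using A(2) unfolding adm[OF A(1)] adm[OF keys] by (auto simp: PiE_def Pi_def)
      show "\<forall>x \<in> admissible G A (carrier G) - admissible G (Poly_Mapping.keys f) (carrier G).
          (\<Prod>s \<in> carrier G. Poly_Mapping.lookup f (x s)) = 0"
        unfolding adm[OF A(1)] adm[OF keys] using assms(2)
        by (auto simp: PiE_def Pi_def in_keys_iff)
    qed
    then show ?thesis by (simp add: local_permanent_def adm[OF keys])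
  qed
  show ?thesis
    unfolding per_def folner_filter_finite[OF assms(1,2)]
  proof (rule the_equality)
    show "\<forall>A \<in> nonempty_finite_subsets G. Poly_Mapping.keys f \<subseteq> A \<longrightarrow>
        (local_permanent G f A \<longlongrightarrow> ?R) (principal {carrier G})"
    proof (intro ballI impI)
      fix A assume A: "A \<in> nonempty_finite_subsets G" "Poly_Mapping.keys f \<subseteq> A"
      show "(local_permanent G f A \<longlongrightarrow> ?R) (principal {carrier G})"
        unfolding R[OF A, symmetric] by (rule tendsto_principal_singleton)
    qed
  next
    fix L assume "\<forall>A \<in> nonempty_finite_subsets G. Poly_Mapping.keys f \<subseteq> A \<longrightarrow>
        (local_permanent G f A \<longlongrightarrow> L) (principal {carrier G})"
    then have "(local_permanent G f (Poly_Mapping.keys f) \<longlongrightarrow> L) (principal {carrier G})"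
      using keys by blast
    moreover have "(local_permanent G f (Poly_Mapping.keys f) \<longlongrightarrow> ?R) (principal {carrier G})"
      unfolding R[OF keys order_refl, symmetric] by (rule tendsto_principal_singleton)
    moreover have "principal {carrier G} \<noteq> bot" by (simp add: principal_eq_bot_iff)
    ultimately show "L = ?R" by (intro tendsto_unique)
  qed
qed

end

theory Submission
  imports Defs
begin

text \<open>
  If \<open>x\<close> lies in \<open>X\<^sub>A\<^sub>,\<^sub>F\<close> and \<open>E \<subseteq> F\<close>, then the restriction of \<open>x\<close> to \<open>E\<close> lies in \<open>X\<^sub>A\<^sub>,\<^sub>E\<close>. Once \<open>f\<close> is
  normalized to total mass 1, the sum over \<open>X\<^sub>A\<^sub>,\<^sub>F\<close> is the probability of a hereditary event for independent
  coordinates, and it is bounded by the product over the translates \<open>gE\<close>, which cover every point of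
  \<open>F\<close> exactly \<open>|E|\<close> times, of the \<open>|E|\<close>-th roots of the corresponding probabilities (Finner's inequality,
  by iterated Hoelder). As almost \<open>|F|\<close> of the translates lie inside a Folner set \<open>F\<close>,
  the defining limit of the permanent exists and equals the infimum over all \<open>E\<close> of the local quantities.
  On a quotient this infimum is at most its value at the image of \<open>E\<close>, and as soon as the quotient map is
  injective on \<open>A \<union> E \<union> EA\<close>, that value is at most the local quantity of \<open>E\<close> in the original group.
\<close>

section \<open>Hoelder and Finner inequalities on finite product spaces\<close>

text \<open>Once each \<open>c i\<close> is divided by its weighted sum \<open>C i\<close>, the
  arithmetic-geometric mean inequality bounds the pointwise geometric mean by an average whose
  weighted sum is 1. If some \<open>C i\<close> is 0, every term on the left is 0.\<close>

lemma weighted_Holder_prod: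
  fixes w :: "'b \<Rightarrow> real" and c :: "'i \<Rightarrow> 'b \<Rightarrow> real"
  assumes "finite A" "finite I" "I \<noteq> {}"
    and w: "\<And>a. a \<in> A \<Longrightarrow> 0 \<le> w a"
    and c: "\<And>i a. i \<in> I \<Longrightarrow> a \<in> A \<Longrightarrow> 0 \<le> c i a"
  shows "(\<Sum>a\<in>A. w a * (\<Prod>i\<in>I. c i a powr (1 / card I))) \<le>
    (\<Prod>i\<in>I. (\<Sum>a\<in>A. w a * c i a) powr (1 / card I))"
proof (cases "\<exists>i\<in>I. (\<Sum>a\<in>A. w a * c i a) = 0")
  case True
  then obtain i where i: "i \<in> I" "(\<Sum>a\<in>A. w a * c i a) = 0" by blast
  have 0: "w a * c i a = 0" if "a \<in> A" for a
    using i that sum_nonneg_eq_0_iff[of A "\<lambda>a. w a * c i a"] assms(1) w c by auto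
  \<comment> \<open>One of \<open>w a\<close> and \<open>c i a\<close> is 0, and
    \<open>0 powr p = 0\<close>, so the whole term vanishes.\<close>
  have "w a * (\<Prod>i\<in>I. c i a powr (1 / card I)) = 0" if "a \<in> A" for a
    using 0[OF that] i(1) assms(2) by auto
  then have "(\<Sum>a\<in>A. w a * (\<Prod>i\<in>I. c i a powr (1 / card I))) = 0" by (intro sum.neutral) blast
  then show ?thesis by (simp add: prod_nonneg)
next
  case False
  define C where "C i = (\<Sum>a\<in>A. w a * c i a)" for i
  have C: "0 < C i" if "i \<in> I" for i
    using False that w c sum_nonneg[of A "\<lambda>a. w a * c i a"]
    unfolding C_def by (metis less_eq_real_def mult_nonneg_nonneg)
  let ?p = "1 / real (card I)"
  let ?P = "\<Prod>i\<in>I. C i powr ?p"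
  have P: "0 < ?P" using C by (intro prod_pos) (simp add: less_le)
  have "(\<Sum>a\<in>A. w a * (\<Prod>i\<in>I. c i a powr ?p)) = ?P * (\<Sum>a\<in>A. w a * (\<Prod>i\<in>I. c i a / C i) powr ?p)"
  proof -
    have "(\<Prod>i\<in>I. c i a powr ?p) = ?P * (\<Prod>i\<in>I. c i a / C i) powr ?p" if "a \<in> A" for a
    proof -
      have "(\<Prod>i\<in>I. c i a / C i) powr ?p = (\<Prod>i\<in>I. c i a powr ?p / C i powr ?p)"
        using that c C by (subst prod_powr_distrib) (auto simp: powr_divide less_imp_le intro!: prod.cong)
      also have "\<dots> = (\<Prod>i\<in>I. c i a powr ?p) / ?P" by (rule prod_dividef)
      finally show ?thesis using P by simp
    qed
    then show ?thesis by (simp add: sum_distrib_left mult.left_commute)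
  qed
  also have "\<dots> \<le> ?P * 1"
  proof (intro mult_left_mono)
    have "(\<Sum>a\<in>A. w a * (\<Prod>i\<in>I. c i a / C i) powr ?p) \<le> (\<Sum>a\<in>A. w a * (\<Sum>i\<in>I. c i a / C i / card I))"
      using w c C assms by (intro sum_mono mult_left_mono arith_geom_mean) (auto simp: less_imp_le)
    also have "\<dots> = (\<Sum>i\<in>I. \<Sum>a\<in>A. w a * (c i a / C i / card I))"
      unfolding sum_distrib_left by (rule sum.swap)
    also have "\<dots> = (\<Sum>i\<in>I. C i / C i / card I)"
      unfolding C_def sum_divide_distrib by simp
    also have "\<dots> = (\<Sum>i\<in>I. 1 / card I)"
      by (rule sum.cong) (use C in \<open>auto simp: less_le\<close>)
    also have "\<dots> = 1" using assms by simp
    finally show "(\<Sum>a\<in>A. w a * (\<Prod>i\<in>I. c i a / C i) powr ?p) \<le> 1" .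
  qed (use P in simp)
  finally show ?thesis by (simp add: C_def)
qed

lemma sum_PiE_insert:
  assumes "s \<notin> F"
  shows "(\<Sum>x \<in> insert s F \<rightarrow>\<^sub>E A. g x) = (\<Sum>a\<in>A. \<Sum>x \<in> F \<rightarrow>\<^sub>E A. g (x(s := a)))"
proof -
  have "inj_on (\<lambda>(a, x). x(s := a)) (A \<times> (F \<rightarrow>\<^sub>E A))"
    using assms by (rule inj_combinator)
  then show ?thesis
    by (simp add: PiE_insert_eq sum.reindex sum.cartesian_product case_prod_unfold)
qed

text \<open>Coordinates are summed out one at a time. Exactly \<open>k\<close> of the factors depend
  on the removed coordinate, so Hoelder with \<open>k\<close> exponents \<open>1 / k\<close> applies
  to them, while the other factors are constant and come out of the sum.\<close>

lemma Finner_inequality: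
  fixes w :: "'b \<Rightarrow> real" and h :: "'i \<Rightarrow> ('s \<Rightarrow> 'b) \<Rightarrow> real"
  assumes "finite F" "finite A" "finite I" "k > 0"
    and w: "\<And>a. a \<in> A \<Longrightarrow> 0 \<le> w a"
    and "\<And>i. i \<in> I \<Longrightarrow> U i \<subseteq> F"
    and "\<And>s. s \<in> F \<Longrightarrow> card {i \<in> I. s \<in> U i} = k"
    and "\<And>i x. i \<in> I \<Longrightarrow> 0 \<le> h i x"
  shows "(\<Sum>x \<in> F \<rightarrow>\<^sub>E A. (\<Prod>s\<in>F. w (x s)) * (\<Prod>i\<in>I. h i (restrict x (U i)) powr (1 / k))) \<le>
    (\<Prod>i\<in>I. (\<Sum>y \<in> U i \<rightarrow>\<^sub>E A. (\<Prod>s\<in>U i. w (y s)) * h i y) powr (1 / k))"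
  using assms(1,6-8)
proof (induction F arbitrary: U h rule: finite_induct)
  case empty
  have "U i = {}" if "i \<in> I" for i using empty(1)[OF that] by simp
  then show ?case by (simp add: restrict_def)
next
  case (insert s F)
  define J where "J = {i \<in> I. s \<in> U i}"
  define W where "W S y = (\<Prod>t\<in>S. w (y t))" for S and y :: "'s \<Rightarrow> 'b"
  define H where "H i = (\<Sum>y \<in> U i \<rightarrow>\<^sub>E A. W (U i) y * h i y)" for i
  \<comment> \<open>\<open>h' a i\<close> is the section of \<open>h i\<close> at the value
    \<open>a\<close> of the coordinate \<open>s\<close>. For fixed \<open>a\<close> the induction
    hypothesis applies to these sections on the smaller sets \<open>U' i\<close>.\<close>
  define h' where "h' a i y = (if i \<in> J then h i (y(s := a)) else h i y)" for a i y
  define U' where "U' i = U i - {s}" for i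
  define H' where "H' a i = (\<Sum>y \<in> U' i \<rightarrow>\<^sub>E A. W (U' i) y * h' a i y)" for a i
  have J: "finite J" "card J = k" "J \<noteq> {}" "J \<subseteq> I"
    using insert.prems(2)[of s] \<open>finite I\<close> card_gt_0_iff[of J] \<open>k > 0\<close> unfolding J_def by auto
  have U'F: "U' i \<subseteq> F" if "i \<in> I" for i using insert.prems(1)[OF that] by (auto simp: U'_def)
  then have finU: "finite (U' i)" if "i \<in> I" for i using that insert.hyps finite_subset by blast
  have Wpos: "0 \<le> W S y" if "y \<in> S \<rightarrow>\<^sub>E A" for S y
    unfolding W_def using that w by (intro prod_nonneg) auto
  have h'_nonneg: "0 \<le> h' a i y" if "i \<in> I" for a i y
    using insert.prems(3)[OF that] by (simp add: h'_def)
  have H'_nonneg: "0 \<le> H' a i" if "i \<in> I" for a i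
    unfolding H'_def using that Wpos h'_nonneg by (intro sum_nonneg mult_nonneg_nonneg) auto
  have h': "h i (restrict (x(s := a)) (U i)) = h' a i (restrict x (U' i))" if "i \<in> I" for a i x
  proof (cases "s \<in> U i")
    case True
    then have "restrict (x(s := a)) (U i) = (restrict x (U' i))(s := a)"
      by (auto simp: U'_def restrict_def)
    with True that show ?thesis by (simp add: h'_def J_def)
  next
    case False
    then have "restrict (x(s := a)) (U i) = restrict x (U' i)"
      by (auto simp: U'_def restrict_def)
    with False show ?thesis by (simp add: h'_def J_def)
  qed
  have W_upd: "W (insert s S) (x(s := a)) = w a * W S x" if "finite S" "s \<notin> S" for S x a
  proof -
    have "(\<Prod>t\<in>S. w ((x(s := a)) t)) = (\<Prod>t\<in>S. w (x t))"
      using that by (intro prod.cong) auto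
    then show ?thesis using that by (simp add: W_def)
  qed
  have H_J: "H i = (\<Sum>a\<in>A. w a * H' a i)" if "i \<in> J" for i
  proof -
    have i: "i \<in> I" "U i = insert s (U' i)" "s \<notin> U' i" using that by (auto simp: J_def U'_def)
    show ?thesis
      unfolding H_def i(2) sum_PiE_insert[OF i(3)] H'_def sum_distrib_left
      using that by (simp add: W_upd finU i(1,3) h'_def mult.assoc)
  qed
  have H_nJ: "H' a i = H i" if "i \<in> I - J" for i a
  proof -
    have "U' i = U i" using that by (auto simp: J_def U'_def)
    then show ?thesis using that by (simp add: H_def H'_def h'_def)
  qed
  have IJ: "prod g I = prod g (I - J) * prod g J" for g :: "'i \<Rightarrow> real"
    using J(4) \<open>finite I\<close> by (rule prod.subset_diff)
  have "(\<Sum>x \<in> insert s F \<rightarrow>\<^sub>E A. W (insert s F) x * (\<Prod>i\<in>I. h i (restrict x (U i)) powr (1 / k)))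
    = (\<Sum>a\<in>A. w a * (\<Sum>x \<in> F \<rightarrow>\<^sub>E A. W F x * (\<Prod>i\<in>I. h' a i (restrict x (U' i)) powr (1 / k))))"
    unfolding sum_PiE_insert[OF insert.hyps(2)] W_upd[OF insert.hyps] sum_distrib_left
    by (intro sum.cong refl) (simp add: h' mult.assoc)
  also have "\<dots> \<le> (\<Sum>a\<in>A. w a * (\<Prod>i\<in>I. H' a i powr (1 / k)))"
  proof (intro sum_mono mult_left_mono w)
    fix a assume "a \<in> A"
    have "card {i \<in> I. t \<in> U' i} = k" if "t \<in> F" for t
    proof -
      have "{i \<in> I. t \<in> U' i} = {i \<in> I. t \<in> U i}" using that insert.hyps by (auto simp: U'_def)
      then show ?thesis using insert.prems(2) that by simp
    qed
    then show "(\<Sum>x \<in> F \<rightarrow>\<^sub>E A. W F x * (\<Prod>i\<in>I. h' a i (restrict x (U' i)) powr (1 / k)))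
      \<le> (\<Prod>i\<in>I. H' a i powr (1 / k))"
      unfolding H'_def W_def by (intro insert.IH U'F h'_nonneg)
  qed
  also have "\<dots> = (\<Prod>i\<in>I - J. H i powr (1 / k)) * (\<Sum>a\<in>A. w a * (\<Prod>i\<in>J. H' a i powr (1 / k)))"
  proof -
    have "(\<Prod>i\<in>I. H' a i powr (1 / k)) = (\<Prod>i\<in>I - J. H i powr (1 / k)) * (\<Prod>i\<in>J. H' a i powr (1 / k))" for a
      unfolding IJ by (simp add: H_nJ)
    then show ?thesis by (simp add: sum_distrib_left mult.left_commute)
  qed
  also have "\<dots> \<le> (\<Prod>i\<in>I - J. H i powr (1 / k)) * (\<Prod>i\<in>J. (\<Sum>a\<in>A. w a * H' a i) powr (1 / k))"
  proof (rule mult_left_mono)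
    show "(\<Sum>a\<in>A. w a * (\<Prod>i\<in>J. H' a i powr (1 / k))) \<le> (\<Prod>i\<in>J. (\<Sum>a\<in>A. w a * H' a i) powr (1 / k))"
      using weighted_Holder_prod[of A J w "\<lambda>i a. H' a i"] J \<open>finite A\<close> w H'_nonneg by auto
  qed (simp add: prod_nonneg)
  also have "\<dots> = (\<Prod>i\<in>I. H i powr (1 / k))"
    unfolding IJ by (simp add: H_J)
  finally show ?case unfolding W_def H_def .
qed


section \<open>Sums over admissible choices\<close>

definition admissible_sum ::
  "('a, 'b) monoid_scheme \<Rightarrow> ('a \<Rightarrow>\<^sub>0 real) \<Rightarrow> 'a set \<Rightarrow> 'a set \<Rightarrow> real"
  where "admissible_sum G f A F =
    (\<Sum>x \<in> admissible G A F. \<Prod>s\<in>F. Poly_Mapping.lookup f (x s))"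

lemma (in group) admissible_iff:
  "x \<in> admissible G A F \<longleftrightarrow> x \<in> F \<rightarrow>\<^sub>E A \<and> inj_on (\<lambda>s. s \<otimes> x s) F \<and>
    (\<forall>s\<in>carrier G. (\<forall>a\<in>A. s \<otimes> inv a \<in> F) \<longrightarrow> (\<exists>t\<in>F. s = t \<otimes> x t))"
proof -
  have eq: "s <# (set_inv A) \<subseteq> F \<longleftrightarrow> (\<forall>a\<in>A. s \<otimes> inv a \<in> F)" for s
    unfolding l_coset_def SET_INV_def by blast
  show ?thesis unfolding admissible_def eq unfolding subset_iff image_iff by blast
qed

lemma finite_admissible:
  assumes "finite F" "finite A"
  shows "finite (admissible G A F)"
  using finite_PiE[of F "\<lambda>_. A"] assms by (auto simp: admissible_def intro: finite_subset)

lemma nonneg_group_ring_lookup: "f \<in> nonneg_group_ring G \<Longrightarrow> 0 \<le> Poly_Mapping.lookup f s"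
  unfolding nonneg_group_ring_def group_ring_def
  by (cases "s \<in> Poly_Mapping.keys f") (auto simp: in_keys_iff)

lemma nonneg_group_ring_keys: "f \<in> nonneg_group_ring G \<Longrightarrow> Poly_Mapping.keys f \<subseteq> carrier G"
  unfolding nonneg_group_ring_def group_ring_def by auto

text \<open>A choice that leaves the support has product 0, so \<open>A\<close> survives only inside
  the admissibility condition. With this condition written as an indicator, the sum becomes an
  integral over a product space, as Finner's inequality requires.\<close>

lemma admissible_sum_eq:
  assumes "Poly_Mapping.keys f \<subseteq> A" "finite F" "finite A"
  shows "admissible_sum G f A F = (\<Sum>x \<in> F \<rightarrow>\<^sub>E Poly_Mapping.keys f.
    (\<Prod>s\<in>F. Poly_Mapping.lookup f (x s)) * of_bool (x \<in> admissible G A F))"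
proof -
  let ?P = "F \<rightarrow>\<^sub>E Poly_Mapping.keys f" and ?W = "\<lambda>x. \<Prod>s\<in>F. Poly_Mapping.lookup f (x s)"
  have "admissible_sum G f A F = (\<Sum>x \<in> ?P \<inter> admissible G A F. ?W x)"
    unfolding admissible_sum_def
  proof (rule sum.mono_neutral_right)
    show "\<forall>x \<in> admissible G A F - ?P \<inter> admissible G A F. ?W x = 0"
      using assms(2) by (auto simp: admissible_def PiE_def Pi_def in_keys_iff)
  qed (use assms in \<open>auto simp: finite_admissible\<close>)
  also have "\<dots> = (\<Sum>x \<in> ?P. ?W x * of_bool (x \<in> admissible G A F))"
    using assms by (simp add: finite_PiE Int_def sum.inter_filter[symmetric] of_bool_def if_distrib
        cong: if_cong)
  finally show ?thesis .
qed

text \<open>A constant choice \<open>a\<close> from the support is always admissible: right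
  multiplication by \<open>a\<close> is injective, and an interior point \<open>s\<close> is the
  image of \<open>s \<otimes> inv a\<close>. Hence all logarithms below are finite for nonzero
  \<open>f\<close>.\<close>

lemma (in group) admissible_sum_pos:
  assumes f: "f \<in> nonneg_group_ring G" "f \<noteq> 0"
    and A: "Poly_Mapping.keys f \<subseteq> A" "finite A" and F: "F \<subseteq> carrier G" "finite F"
  shows "0 < admissible_sum G f A F"
proof -
  obtain a where a: "a \<in> Poly_Mapping.keys f" using f(2) keys_eq_empty[of f] by blast
  then have aG: "a \<in> carrier G" and aA: "a \<in> A"
    using nonneg_group_ring_keys[OF f(1)] A by auto
  let ?x = "\<lambda>s\<in>F. a"
  have "inj_on (\<lambda>s. s \<otimes> ?x s) F"
    by (rule inj_onI) (metis F(1) aG right_cancel restrict_apply' subsetD)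
  moreover have "\<exists>t\<in>F. s = t \<otimes> ?x t" if "s \<in> carrier G" "\<forall>a\<in>A. s \<otimes> inv a \<in> F" for s
    using that aA aG by (intro bexI[of _ "s \<otimes> inv a"]) (auto simp: m_assoc)
  ultimately have x: "?x \<in> admissible G A F"
    using aA by (auto simp: admissible_iff)
  have "0 < (\<Prod>s\<in>F. Poly_Mapping.lookup f (?x s))"
    using a nonneg_group_ring_lookup[OF f(1), of a] by (intro prod_pos) (auto simp: in_keys_iff)
  also have "\<dots> \<le> admissible_sum G f A F"
    unfolding admissible_sum_def
    by (rule member_le_sum[OF x])
      (auto simp: finite_admissible A F intro!: prod_nonneg nonneg_group_ring_lookup[OF f(1)])
  finally show ?thesis .
qed

text \<open>Dropping the indicator leaves a sum that factorizes over the coordinates. The bound says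
  that the normalized sums are at most 1, that is, have nonpositive logarithm.\<close>

lemma admissible_sum_le_power:
  assumes "f \<in> nonneg_group_ring G" "Poly_Mapping.keys f \<subseteq> A" "finite F" "finite A"
  shows "admissible_sum G f A F \<le> (\<Sum>a\<in>Poly_Mapping.keys f. Poly_Mapping.lookup f a) ^ card F"
proof -
  have "admissible_sum G f A F \<le>
      (\<Sum>x \<in> F \<rightarrow>\<^sub>E Poly_Mapping.keys f. \<Prod>s\<in>F. Poly_Mapping.lookup f (x s))"
    unfolding admissible_sum_eq[OF assms(2-4)]
    by (intro sum_mono mult_left_le prod_nonneg nonneg_group_ring_lookup[OF assms(1)]) auto
  also have "\<dots> = (\<Prod>s\<in>F. \<Sum>a\<in>Poly_Mapping.keys f. Poly_Mapping.lookup f a)"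
    using assms(3) by (intro prod_sum_PiE[symmetric]) auto
  finally show ?thesis by simp
qed

section \<open>Transfer along locally injective maps, and restriction to subsets\<close>

text \<open>Every admissible choice on the image pulls back to an admissible choice of equal weight.
  Points move by \<open>\<theta>\<close> and labels by \<open>\<pi>\<close>; keeping the two maps
  apart covers both left translations, where labels stay fixed, and homomorphisms that are injective
  on a finite set.\<close>

lemma admissible_sum_transfer:
  assumes "group G" "group H" "finite E" "finite A" "E \<subseteq> carrier G" "A \<subseteq> carrier G"
    and E': "\<theta> ` E \<subseteq> carrier H" and A': "\<pi> ` A \<subseteq> carrier H"
    and \<theta>: "inj_on \<theta> (E \<union> (E <#>\<^bsub>G\<^esub> A))" and \<pi>: "inj_on \<pi> A"
    and mult: "\<And>s a. s \<in> E \<Longrightarrow> a \<in> A \<Longrightarrow> \<theta> (s \<otimes>\<^bsub>G\<^esub> a) = \<theta> s \<otimes>\<^bsub>H\<^esub> \<pi> a"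
    and h: "\<And>a. a \<in> A \<Longrightarrow> Poly_Mapping.lookup h (\<pi> a) = Poly_Mapping.lookup f a"
    and f: "f \<in> nonneg_group_ring G" and ne: "A \<noteq> {}"
  shows "admissible_sum H h (\<pi> ` A) (\<theta> ` E) \<le> admissible_sum G f A E"
proof -
  interpret G: group G by fact
  interpret H: group H by fact
  have inj: "inj_on \<theta> E" "inj_on \<theta> (E <#>\<^bsub>G\<^esub> A)" using \<theta> by (auto intro: inj_on_subset)
  \<comment> \<open>\<open>\<Phi>\<close> carries choices on \<open>E\<close> forward to the image.
    Since it recovers \<open>y\<close> from its pullback \<open>x\<close>, distinct \<open>y\<close>
    have distinct pullbacks, and the sums can be compared term by term.\<close>
  define \<Phi> where "\<Phi> x = (\<lambda>t \<in> \<theta> ` E. \<pi> (x (the_inv_into E \<theta> t)))" for x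
  have "\<exists>x \<in> admissible G A E. \<Phi> x = y \<and> (\<Prod>t\<in>\<theta> ` E. Poly_Mapping.lookup h (y t)) \<le>
      (\<Prod>s\<in>E. Poly_Mapping.lookup f (x s))"
    if y: "y \<in> admissible H (\<pi> ` A) (\<theta> ` E)" for y
  proof -
    define x where "x = (\<lambda>s\<in>E. the_inv_into A \<pi> (y (\<theta> s)))"
    have yA: "y \<in> \<theta> ` E \<rightarrow>\<^sub>E \<pi> ` A" and y_inj: "inj_on (\<lambda>t. t \<otimes>\<^bsub>H\<^esub> y t) (\<theta> ` E)"
      and y_cov: "\<And>t. t \<in> carrier H \<Longrightarrow> (\<forall>b\<in>\<pi> ` A. t \<otimes>\<^bsub>H\<^esub> inv\<^bsub>H\<^esub> b \<in> \<theta> ` E) \<Longrightarrow>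
        (\<exists>u\<in>\<theta> ` E. t = u \<otimes>\<^bsub>H\<^esub> y u)"
      using y unfolding H.admissible_iff by auto
    have xA: "x s \<in> A" and \<pi>x: "\<pi> (x s) = y (\<theta> s)" if "s \<in> E" for s
      using that yA the_inv_into_into[OF \<pi>, of "y (\<theta> s)" A] f_the_inv_into_f[OF \<pi>, of "y (\<theta> s)"]
      by (auto simp: x_def)
    have \<theta>x: "\<theta> (s \<otimes>\<^bsub>G\<^esub> x s) = \<theta> s \<otimes>\<^bsub>H\<^esub> y (\<theta> s)" if "s \<in> E" for s
      using that by (simp add: mult xA \<pi>x)
    have "x \<in> admissible G A E"
      unfolding G.admissible_iff
    proof (intro conjI ballI impI)
      show "x \<in> E \<rightarrow>\<^sub>E A" using xA by (auto simp: x_def)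
      show "inj_on (\<lambda>s. s \<otimes>\<^bsub>G\<^esub> x s) E"
      proof (rule inj_onI)
        fix s t assume st: "s \<in> E" "t \<in> E" "s \<otimes>\<^bsub>G\<^esub> x s = t \<otimes>\<^bsub>G\<^esub> x t"
        then have "\<theta> s \<otimes>\<^bsub>H\<^esub> y (\<theta> s) = \<theta> t \<otimes>\<^bsub>H\<^esub> y (\<theta> t)" by (metis \<theta>x)
        with st y_inj inj(1) show "s = t" by (auto dest!: inj_onD)
      qed
    next
      fix s assume s: "s \<in> carrier G" "\<forall>a\<in>A. s \<otimes>\<^bsub>G\<^esub> inv\<^bsub>G\<^esub> a \<in> E"
      have s_eq: "s = (s \<otimes>\<^bsub>G\<^esub> inv\<^bsub>G\<^esub> a) \<otimes>\<^bsub>G\<^esub> a" if "a \<in> A" for a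
        using that s(1) assms(6) by (auto simp: G.m_assoc subset_iff)
      have \<theta>s: "\<theta> s = \<theta> (s \<otimes>\<^bsub>G\<^esub> inv\<^bsub>G\<^esub> a) \<otimes>\<^bsub>H\<^esub> \<pi> a" if "a \<in> A" for a
        using s(2) that s_eq[OF that] mult[of "s \<otimes>\<^bsub>G\<^esub> inv\<^bsub>G\<^esub> a" a] by simp
      \<comment> \<open>Nonemptiness of \<open>A\<close> places the interior point \<open>s\<close>
        in \<open>E <#> A\<close>, where \<open>\<theta>\<close> is injective, so that a point
        covering \<open>\<theta> s\<close> can be pulled back to one covering
        \<open>s\<close>.\<close>
      obtain a where a: "a \<in> A" using ne by blast
      have sEA: "s \<in> E <#>\<^bsub>G\<^esub> A" using s_eq[OF a] s(2) a unfolding set_mult_def by blast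
      have "\<theta> s \<otimes>\<^bsub>H\<^esub> inv\<^bsub>H\<^esub> (\<pi> a) \<in> \<theta> ` E" if "a \<in> A" for a
      proof -
        have "\<theta> (s \<otimes>\<^bsub>G\<^esub> inv\<^bsub>G\<^esub> a) \<in> carrier H" "\<pi> a \<in> carrier H" using s(2) that E' A' by auto
        then have "\<theta> s \<otimes>\<^bsub>H\<^esub> inv\<^bsub>H\<^esub> (\<pi> a) = \<theta> (s \<otimes>\<^bsub>G\<^esub> inv\<^bsub>G\<^esub> a)"
          using \<theta>s[OF that] by (simp add: H.m_assoc)
        then show ?thesis using s(2) that by simp
      qed
      moreover have "\<theta> (s \<otimes>\<^bsub>G\<^esub> inv\<^bsub>G\<^esub> a) \<in> carrier H" "\<pi> a \<in> carrier H" using s(2) a E' A' by auto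
      then have "\<theta> s \<in> carrier H" by (simp add: \<theta>s[OF a])
      ultimately obtain u where u: "u \<in> E" "\<theta> s = \<theta> u \<otimes>\<^bsub>H\<^esub> y (\<theta> u)" using y_cov[of "\<theta> s"] by auto
      then have "\<theta> s = \<theta> (u \<otimes>\<^bsub>G\<^esub> x u)" by (simp add: \<theta>x)
      moreover have "u \<otimes>\<^bsub>G\<^esub> x u \<in> E <#>\<^bsub>G\<^esub> A" using u(1) xA unfolding set_mult_def by blast
      ultimately show "\<exists>u\<in>E. s = u \<otimes>\<^bsub>G\<^esub> x u" using inj(2) sEA u(1) by (auto dest: inj_onD)
    qed
    moreover have "\<Phi> x = y"
    proof (rule extensionalityI[of _ "\<theta> ` E"])
      show "\<Phi> x t = y t" if "t \<in> \<theta> ` E" for t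
        using that by (auto simp: \<Phi>_def the_inv_into_f_f[OF inj(1)] \<pi>x)
    qed (use yA in \<open>auto simp: \<Phi>_def PiE_def\<close>)
    moreover have "(\<Prod>t\<in>\<theta> ` E. Poly_Mapping.lookup h (y t)) = (\<Prod>s\<in>E. Poly_Mapping.lookup f (x s))"
      using inj(1) by (subst prod.reindex) (auto simp: \<pi>x[symmetric] h xA intro!: prod.cong)
    ultimately show ?thesis by auto
  qed
  then show ?thesis
    unfolding admissible_sum_def
    by (intro sum_le_included[where i = \<Phi>])
      (auto simp: assms finite_admissible intro!: prod_nonneg nonneg_group_ring_lookup[OF f])
qed

text \<open>Left translation commutes with right multiplication by the labels, so the transfer
  applies with \<open>\<pi>\<close> the identity.\<close>

lemma (in group) admissible_sum_translate:
  assumes "finite E" "finite A" "E \<subseteq> carrier G" "A \<subseteq> carrier G" "A \<noteq> {}" "g \<in> carrier G"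
    and "f \<in> nonneg_group_ring G"
  shows "admissible_sum G f A ((\<lambda>s. g \<otimes> s) ` E) \<le> admissible_sum G f A E"
proof -
  have "inj_on (\<lambda>s. g \<otimes> s) (E \<union> (E <#> A))"
    using assms set_mult_closed[of E A] by (auto simp: inj_on_def subset_iff)
  then show ?thesis
    using admissible_sum_transfer[of G G E A "\<lambda>s. g \<otimes> s" "\<lambda>a. a" f f] assms is_group
    by (auto simp: m_assoc subset_iff)
qed

text \<open>The last assumption turns an \<open>A\<close>-interior point of \<open>E\<close> into an \<open>A'\<close>-interior point of \<open>F\<close>; it makes
  the permanent independent of the chosen finite set.\<close>

lemma (in group) restrict_admissible:
  assumes x: "x \<in> admissible G A' F" and xA: "x \<in> F \<rightarrow>\<^sub>E A"
    and carrier: "A \<subseteq> carrier G" "A' \<subseteq> carrier G" "E \<subseteq> F" "F \<subseteq> carrier G"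
    and A: "A \<noteq> {}" "\<And>s a a'. s \<in> E \<Longrightarrow> a \<in> A \<Longrightarrow> a' \<in> A' \<Longrightarrow> s \<otimes> a \<otimes> inv a' \<in> F"
  shows "restrict x E \<in> admissible G A E"
  unfolding admissible_iff
proof (intro conjI ballI impI)
  show "restrict x E \<in> E \<rightarrow>\<^sub>E A" using xA carrier(3) by auto
  have "inj_on (\<lambda>s. s \<otimes> x s) F" using x by (simp add: admissible_iff)
  then show "inj_on (\<lambda>s. s \<otimes> restrict x E s) E" using carrier(3) by (auto simp: inj_on_def subset_iff)
next
  fix s assume s: "s \<in> carrier G" "\<forall>a\<in>A. s \<otimes> inv a \<in> E"
  obtain a where a: "a \<in> A" using A by blast
  then have "s \<otimes> inv a \<otimes> a = s" using carrier s by (auto simp: m_assoc subset_iff)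
  then have "\<forall>a'\<in>A'. s \<otimes> inv a' \<in> F" using A(2)[of "s \<otimes> inv a" a] s a by auto
  then obtain t where t: "t \<in> F" "s = t \<otimes> x t" using x s(1) by (auto simp: admissible_iff)
  \<comment> \<open>The covering point \<open>t\<close>, so far only known to lie in
    \<open>F\<close>, equals \<open>s \<otimes> inv (x t)\<close>. As its label lies in
    \<open>A\<close>, interiority of \<open>s\<close> forces \<open>t\<close> into
    \<open>E\<close>.\<close>
  then have "x t \<in> A" using xA by auto
  moreover from this have "s \<otimes> inv (x t) = t" using t carrier by (auto simp: m_assoc subset_iff)
  ultimately have "t \<in> E" using s by force
  then show "\<exists>t\<in>E. s = t \<otimes> restrict x E t" using t by auto
qed

section \<open>Translates of a finite set inside a Folner set\<close>

definition (in group) folner_core :: "'a set \<Rightarrow> 'a set \<Rightarrow> 'a set"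
  where "folner_core K F = {g \<in> F. \<forall>k\<in>K. g \<otimes> k \<in> F}"

text \<open>A point of \<open>F\<close> outside the core is pushed out of \<open>F\<close> by some
  \<open>k\<close> in \<open>K\<close>. For each \<open>k\<close> such points inject into
  \<open>F <#> K\<close> minus \<open>F\<close> via right multiplication, so a union bound over
  \<open>K\<close> suffices.\<close>

lemma (in group) card_folner_core:
  fixes \<delta> :: real
  assumes F: "F \<in> folner_sets G K \<delta>" and K: "K \<subseteq> carrier G" "finite K"
  shows "(1 - card K * \<delta>) * card F \<le> card (folner_core K F)"
proof -
  have FG: "F \<subseteq> carrier G" "finite F" using F by (auto simp: folner_sets_def nonempty_finite_subsets_def)
  have fin: "finite (F <#> K)" using FG K by (auto simp: set_mult_def)
  have "card {g \<in> F. g \<otimes> k \<notin> F} \<le> card (sym_diff (F <#> K) F)" if "k \<in> K" for k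
  proof (rule card_inj_on_le)
    show "inj_on (\<lambda>g. g \<otimes> k) {g \<in> F. g \<otimes> k \<notin> F}" using FG K that by (auto simp: inj_on_def subset_iff)
    show "(\<lambda>g. g \<otimes> k) ` {g \<in> F. g \<otimes> k \<notin> F} \<subseteq> sym_diff (F <#> K) F"
      using that by (auto simp: set_mult_def)
  qed (use fin FG in auto)
  then have "(\<Sum>k\<in>K. card {g \<in> F. g \<otimes> k \<notin> F}) \<le> card K * card (sym_diff (F <#> K) F)"
    using sum_bounded_above[of K "\<lambda>k. card {g \<in> F. g \<otimes> k \<notin> F}"] by simp
  moreover have "F - folner_core K F = (\<Union>k\<in>K. {g \<in> F. g \<otimes> k \<notin> F})" by (auto simp: folner_core_def)
  ultimately have "card (F - folner_core K F) \<le> card K * card (sym_diff (F <#> K) F)"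
    using card_UN_le[OF K(2), of "\<lambda>k. {g \<in> F. g \<otimes> k \<notin> F}"] by simp
  moreover have "card (F - folner_core K F) = card F - card (folner_core K F)"
    using FG by (intro card_Diff_subset) (auto simp: folner_core_def)
  ultimately have "card F \<le> card (folner_core K F) + card K * card (sym_diff (F <#> K) F)" by linarith
  then have "real (card F) \<le> card (folner_core K F) + card K * real (card (sym_diff (F <#> K) F))"
    by (metis of_nat_add of_nat_le_iff of_nat_mult)
  also have "\<dots> \<le> card (folner_core K F) + card K * (\<delta> * card F)"
    using F by (intro add_left_mono mult_left_mono) (auto simp: folner_sets_def)
  finally show ?thesis by (simp add: algebra_simps)
qed

text \<open>The equation \<open>s = g \<otimes> e\<close> determines \<open>g\<close> from
  \<open>e\<close>. This is the constant covering multiplicity in Finner's inequality.\<close>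

lemma (in group) card_translates_containing:
  assumes "finite E" "E \<subseteq> carrier G" "s \<in> carrier G"
  shows "card {g \<in> carrier G. s \<in> (\<lambda>e. g \<otimes> e) ` E} = card E"
proof -
  have "{g \<in> carrier G. s \<in> (\<lambda>e. g \<otimes> e) ` E} = (\<lambda>e. s \<otimes> inv e) ` E"
  proof (intro equalityI subsetI)
    fix g assume "g \<in> {g \<in> carrier G. s \<in> (\<lambda>e. g \<otimes> e) ` E}"
    then obtain e where "g \<in> carrier G" "e \<in> E" "s = g \<otimes> e" by blast
    then show "g \<in> (\<lambda>e. s \<otimes> inv e) ` E"
      using assms by (intro image_eqI[of _ _ e]) (auto simp: m_assoc subset_iff)
  next
    fix g assume "g \<in> (\<lambda>e. s \<otimes> inv e) ` E"
    then obtain e where e: "e \<in> E" "e \<in> carrier G" "g = s \<otimes> inv e" using assms by blast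
    then have "s = g \<otimes> e" using assms by (simp add: m_assoc)
    then show "g \<in> {g \<in> carrier G. s \<in> (\<lambda>e. g \<otimes> e) ` E}" using e assms by auto
  qed
  moreover have "inj_on (\<lambda>e. s \<otimes> inv e) E"
    using assms by (auto simp: inj_on_def subset_iff)
  ultimately show ?thesis by (simp add: card_image)
qed

text \<open>Finner's inequality is applied to the translates of \<open>E\<close> cut down to
  \<open>F\<close>. The part \<open>E\<close> of \<open>K\<close> makes core translates lie inside
  \<open>F\<close>; the part built from \<open>A\<close> and \<open>A'\<close> supplies the interior
  condition for restricting admissible choices. Each core translate contributes at most the
  \<open>card E\<close>-th root of the normalized sum of \<open>E\<close>, every other one at most
  1.\<close>

lemma (in group) admissible_sum_Shearer:
  fixes A A' E :: "'a set"
  defines "K \<equiv> E \<union> (\<lambda>(s, a, a'). s \<otimes> a \<otimes> inv a') ` (E \<times> A \<times> A')"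
  assumes f: "f \<in> nonneg_group_ring G" "f \<noteq> 0"
    and A: "Poly_Mapping.keys f \<subseteq> A" "A \<subseteq> carrier G" "finite A"
    and A': "Poly_Mapping.keys f \<subseteq> A'" "A' \<subseteq> carrier G" "finite A'"
    and E: "E \<subseteq> carrier G" "finite E" "E \<noteq> {}" and F: "F \<subseteq> carrier G" "finite F"
    and c: "c = (\<Sum>a\<in>Poly_Mapping.keys f. Poly_Mapping.lookup f a)" "0 < c"
  shows "admissible_sum G f A' F / c ^ card F \<le>
    (admissible_sum G f A E / c ^ card E) powr (card (folner_core K F) / card E)"
proof -
  define S where "S = Poly_Mapping.keys f"
  define w where "w a = Poly_Mapping.lookup f a / c" for a
  \<comment> \<open>Translates crossing the boundary are truncated instead of discarded, so each
    point of \<open>F\<close> is still covered exactly \<open>card E\<close> times.\<close>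
  define U where "U g = (\<lambda>e. g \<otimes> e) ` E \<inter> F" for g
  define I where "I = {g \<in> carrier G. U g \<noteq> {}}"
  define core where "core = folner_core K F"
  \<comment> \<open>Off the core the implication is vacuous and \<open>h\<close> is constantly 1, so
    truncated translates impose no condition.\<close>
  define h :: "'a \<Rightarrow> ('a \<Rightarrow> 'a) \<Rightarrow> real"
    where "h g y = of_bool (g \<in> core \<longrightarrow> y \<in> admissible G A (U g))" for g y
  define q where "q = admissible_sum G f A E / c ^ card E"
  let ?p = "1 / real (card E)"
  have S: "finite S" "S \<noteq> {}" using f(2) by (simp_all add: S_def)
  have A_ne: "A \<noteq> {}" using S A by (auto simp: S_def)
  have q: "0 < q"
    using admissible_sum_pos[OF f A(1,3) E(1,2)] c(2) by (simp add: q_def)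
  have w: "0 \<le> w a" for a using c(2) nonneg_group_ring_lookup[OF f(1)] by (simp add: w_def)
  have w_sum: "(\<Sum>a\<in>S. w a) = 1"
    using c by (simp add: w_def S_def sum_divide_distrib[symmetric])
  have normalized: "(\<Sum>x \<in> V \<rightarrow>\<^sub>E S. (\<Prod>s\<in>V. w (x s)) * of_bool (x \<in> admissible G B V)) =
      admissible_sum G f B V / c ^ card V"
    if "finite V" "S \<subseteq> B" "finite B" for V B
    using that by (simp add: S_def admissible_sum_eq w_def prod_dividef sum_divide_distrib)
  have finU: "finite (U g)" for g using F by (simp add: U_def)
  have finI: "finite I"
  proof (rule finite_subset)
    show "I \<subseteq> (\<lambda>(s, e). s \<otimes> inv e) ` (F \<times> E)"
    proof
      fix g assume "g \<in> I"
      then obtain e where "g \<in> carrier G" "e \<in> E" "g \<otimes> e \<in> F" by (auto simp: I_def U_def)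
      then show "g \<in> (\<lambda>(s, e). s \<otimes> inv e) ` (F \<times> E)"
        using E by (intro image_eqI[of _ _ "(g \<otimes> e, e)"]) (auto simp: m_assoc subset_iff)
    qed
  qed (use E F in auto)
  have U_core: "U g = (\<lambda>e. g \<otimes> e) ` E" if "g \<in> core" for g
    using that by (auto simp: core_def folner_core_def U_def K_def)
  have core: "core \<subseteq> I" "core \<subseteq> carrier G"
    using E(3) F U_core by (auto simp: I_def core_def folner_core_def)
  have cover: "card {g \<in> I. s \<in> U g} = card E" if "s \<in> F" for s
  proof -
    have "{g \<in> I. s \<in> U g} = {g \<in> carrier G. s \<in> (\<lambda>e. g \<otimes> e) ` E}"
      using that by (auto simp: I_def U_def)
    then show ?thesis using card_translates_containing[OF E(2,1)] that F by auto
  qed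
  have h_one: "h g (restrict x (U g)) = 1" if "x \<in> admissible G A' F" "x \<in> F \<rightarrow>\<^sub>E S" for g x
  proof -
    have "restrict x (U g) \<in> admissible G A (U g)" if g: "g \<in> core"
    proof (rule restrict_admissible[OF \<open>x \<in> admissible G A' F\<close>])
      show "x \<in> F \<rightarrow>\<^sub>E A" using \<open>x \<in> F \<rightarrow>\<^sub>E S\<close> A by (auto simp: S_def)
      fix s a a' assume "s \<in> U g" "a \<in> A" "a' \<in> A'"
      then obtain e where e: "e \<in> E" "s = g \<otimes> e" by (auto simp: U_def)
      then have "e \<otimes> a \<otimes> inv a' \<in> K" using \<open>a \<in> A\<close> \<open>a' \<in> A'\<close> by (force simp: K_def)
      then have "g \<otimes> (e \<otimes> a \<otimes> inv a') \<in> F" using g by (simp add: core_def folner_core_def)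
      moreover have "g \<in> carrier G" "e \<in> carrier G" "a \<in> carrier G" "a' \<in> carrier G"
        using g core e E A A' \<open>a \<in> A\<close> \<open>a' \<in> A'\<close> by auto
      ultimately show "s \<otimes> a \<otimes> inv a' \<in> F" using e by (simp add: m_assoc)
    qed (use A A' A_ne F in \<open>auto simp: U_def\<close>)
    then show ?thesis by (simp add: h_def)
  qed
  have marginal: "(\<Sum>y \<in> U g \<rightarrow>\<^sub>E S. (\<Prod>s\<in>U g. w (y s)) * h g y) \<le> (if g \<in> core then q else 1)"
    if "g \<in> I" for g
  proof (cases "g \<in> core")
    case False
    have "(\<Sum>y \<in> U g \<rightarrow>\<^sub>E S. \<Prod>s\<in>U g. w (y s)) = (\<Prod>s\<in>U g. \<Sum>a\<in>S. w a)"
      using finU S by (intro prod_sum_PiE[symmetric]) auto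
    then show ?thesis using False by (simp add: h_def w_sum)
  next
    case True
    then have g: "g \<in> carrier G" using core by auto
    then have "card (U g) = card E"
      unfolding U_core[OF True] using E by (intro card_image) (auto simp: inj_on_def subset_iff)
    then have "(\<Sum>y \<in> U g \<rightarrow>\<^sub>E S. (\<Prod>s\<in>U g. w (y s)) * h g y) = admissible_sum G f A (U g) / c ^ card E"
      using True normalized[of "U g" A] finU A by (simp add: h_def S_def)
    also have "\<dots> \<le> q"
      unfolding q_def U_core[OF True] using admissible_sum_translate[OF E(2) A(3) E(1) A(2) A_ne g f(1)] c(2)
      by (intro divide_right_mono) auto
    finally show ?thesis using True by simp
  qed
  have "admissible_sum G f A' F / c ^ card F =
      (\<Sum>x \<in> F \<rightarrow>\<^sub>E S. (\<Prod>s\<in>F. w (x s)) * of_bool (x \<in> admissible G A' F))"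
    using normalized[of F A'] F A' by (simp add: S_def)
  \<comment> \<open>For admissible \<open>x\<close> all factors \<open>h\<close> are 1 by
    \<open>h_one\<close>; for other \<open>x\<close> the indicator is 0.\<close>
  also have "\<dots> \<le> (\<Sum>x \<in> F \<rightarrow>\<^sub>E S. (\<Prod>s\<in>F. w (x s)) * (\<Prod>g\<in>I. h g (restrict x (U g)) powr ?p))"
  proof (intro sum_mono mult_left_mono prod_nonneg w)
    fix x assume "x \<in> F \<rightarrow>\<^sub>E S"
    then show "of_bool (x \<in> admissible G A' F) \<le> (\<Prod>g\<in>I. h g (restrict x (U g)) powr ?p)"
      by (cases "x \<in> admissible G A' F") (auto simp: h_one intro: prod_nonneg)
  qed
  also have "\<dots> \<le> (\<Prod>g\<in>I. (\<Sum>y \<in> U g \<rightarrow>\<^sub>E S. (\<Prod>s\<in>U g. w (y s)) * h g y) powr ?p)"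
    by (rule Finner_inequality)
      (use F S finI E cover w in \<open>auto simp: card_gt_0_iff h_def U_def\<close>)
  also have "\<dots> \<le> (\<Prod>g\<in>I. (if g \<in> core then q else 1) powr ?p)"
    by (intro prod_mono conjI powr_mono2 marginal sum_nonneg mult_nonneg_nonneg prod_nonneg w)
      (auto simp: h_def)
  also have "\<dots> = (\<Prod>g\<in>I. if g \<in> core then q powr ?p else 1)"
    by (intro prod.cong) auto
  also have "\<dots> = (q powr ?p) ^ card core"
    using core finI by (simp add: prod.If_cases Int_absorb1)
  also have "\<dots> = q powr (card core / card E)"
    using q by (simp add: powr_power)
  finally show ?thesis by (simp add: q_def core_def)
qed

section \<open>The permanent as an infimum\<close>

lemma local_permanent_eq_ln:
  assumes "group G" "f \<in> nonneg_group_ring G" "f \<noteq> 0" "Poly_Mapping.keys f \<subseteq> A" "finite A"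
    and "F \<in> nonempty_finite_subsets G"
  shows "local_permanent G f A F = ereal (ln (admissible_sum G f A F) / card F)"
  using group.admissible_sum_pos[OF assms(1-5), of F] assms(6)
  unfolding local_permanent_def admissible_sum_def[symmetric] log_ereal_def
  by (simp add: nonempty_finite_subsets_def)

lemma local_permanent_zero:
  assumes "F \<in> nonempty_finite_subsets G"
  shows "local_permanent G 0 A F = -\<infinity>"
proof -
  have F: "finite F" "F \<noteq> {}" using assms by (auto simp: nonempty_finite_subsets_def)
  have "(\<Sum>x\<in>admissible G A F. \<Prod>s\<in>F. Poly_Mapping.lookup 0 (x s)) = (0::real)"
    using F by (intro sum.neutral) (simp add: card_gt_0_iff)
  then have "local_permanent G 0 A F = ereal (1 / real (card F)) * log_ereal 0"
    by (simp only: local_permanent_def)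
  \<comment> \<open>Positivity matters: in \<open>ereal\<close> a zero factor times minus infinity
    would be 0.\<close>
  moreover have "0 < card F" using F by (simp add: card_gt_0_iff)
  ultimately show ?thesis by (simp add: log_ereal_def)
qed

text \<open>Let \<open>\<psi>\<close> be the local value at \<open>E\<close> and \<open>d\<close>
  the gap between it and \<open>ln c\<close>. Taking logarithms in the covering estimate and
  bounding the core from below gives a local value at \<open>F\<close> of at most
  \<open>\<psi> + card K * \<delta> * d\<close>. Allowing \<open>A'\<close> to differ from
  \<open>A\<close> yields independence of the limit from the finite set.\<close>

lemma (in group) eventually_local_permanent_less:
  assumes f: "f \<in> nonneg_group_ring G"
    and A: "Poly_Mapping.keys f \<subseteq> A" "A \<in> nonempty_finite_subsets G"
    and A': "Poly_Mapping.keys f \<subseteq> A'" "A' \<in> nonempty_finite_subsets G"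
    and E: "E \<in> nonempty_finite_subsets G" and u: "local_permanent G f A E < u"
  shows "eventually (\<lambda>F. local_permanent G f A' F < u) (folner_filter G)"
proof (cases "f = 0")
  case True
  \<comment> \<open>For \<open>f = 0\<close> there is no mass to normalize by, but every local value
    is minus infinity.\<close>
  have "eventually (\<lambda>F. F \<in> nonempty_finite_subsets G) (folner_filter G)"
    unfolding eventually_folner_filter[OF is_group]
    using E by (intro bexI[of _ E] exI[of _ 1]) (auto simp: folner_sets_def)
  then show ?thesis
    by (rule eventually_mono) (use u in \<open>simp add: True local_permanent_zero[OF E] local_permanent_zero\<close>)
next
  case False
  define c where "c = (\<Sum>a\<in>Poly_Mapping.keys f. Poly_Mapping.lookup f a)"
  define K where "K = E \<union> (\<lambda>(s, a, a'). s \<otimes> a \<otimes> inv a') ` (E \<times> A \<times> A')"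
  define \<psi> where "\<psi> = ln (admissible_sum G f A E) / card E"
  define d where "d = ln c - \<psi>"
  have fin: "finite A" "A \<subseteq> carrier G" "finite A'" "A' \<subseteq> carrier G" "finite E" "E \<subseteq> carrier G" "E \<noteq> {}"
    using A(2) A'(2) E by (auto simp: nonempty_finite_subsets_def)
  have c: "0 < c"
    unfolding c_def using False nonneg_group_ring_lookup[OF f]
    by (intro sum_pos) (auto simp: less_le in_keys_iff)
  have E0: "0 < real (card E)" using fin by (simp add: card_gt_0_iff)
  have K: "K \<in> nonempty_finite_subsets G" "K \<subseteq> carrier G" "finite K"
    using fin by (auto simp: K_def nonempty_finite_subsets_def subset_iff)
  then have K0: "0 < real (card K)" by (auto simp: nonempty_finite_subsets_def card_gt_0_iff)
  have posE: "0 < admissible_sum G f A E" using admissible_sum_pos[OF f False A(1)] fin by auto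
  have "ln (admissible_sum G f A E) \<le> card E * ln c"
    using ln_mono[OF admissible_sum_le_power[OF f A(1) fin(5,1)] posE] c
    by (simp add: ln_realpow c_def)
  then have d: "0 \<le> d" using E0 by (simp add: d_def \<psi>_def field_simps)
  obtain r where r: "\<psi> < r" "ereal r < u"
    using u ereal_dense2[of "ereal \<psi>" u] local_permanent_eq_ln[OF is_group f False A(1) fin(1) E]
    by (auto simp: \<psi>_def)
  \<comment> \<open>The divisor uses \<open>d + 1\<close> because \<open>d\<close> may be 0; it also
    makes the bound \<open>\<delta>d\<close> strict.\<close>
  define \<delta> where "\<delta> = (r - \<psi>) / (card K * (d + 1))"
  have \<delta>: "0 < \<delta>" using r K0 d by (simp add: \<delta>_def)
  have "card K * \<delta> * (d + 1) = r - \<psi>" using K0 d by (simp add: \<delta>_def)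
  moreover have "0 < card K * \<delta>" using K0 \<delta> by simp
  ultimately have \<delta>d: "card K * \<delta> * d < r - \<psi>" by (simp add: algebra_simps)
  have "local_permanent G f A' F < u" if F: "F \<in> folner_sets G K \<delta>" for F
  proof -
    have F': "F \<in> nonempty_finite_subsets G" "F \<subseteq> carrier G" "finite F" "F \<noteq> {}"
      using F by (auto simp: folner_sets_def nonempty_finite_subsets_def)
    then have F0: "0 < real (card F)" by (simp add: card_gt_0_iff)
    have posF: "0 < admissible_sum G f A' F" using admissible_sum_pos[OF f False A'(1)] fin F' by auto
    let ?N = "card (folner_core K F)"
    have "ln (admissible_sum G f A' F / c ^ card F) \<le>
        ln ((admissible_sum G f A E / c ^ card E) powr (?N / card E))"
      using admissible_sum_Shearer[OF f False A(1) fin(2,1) A'(1) fin(4,3,6,5,7) F'(2,3) c_def c]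
        posF c by (intro ln_mono) (auto simp: K_def)
    then have "ln (admissible_sum G f A' F) - card F * ln c \<le>
        ?N / card E * (ln (admissible_sum G f A E) - card E * ln c)"
      using posF posE c by (simp add: ln_div ln_powr ln_realpow)
    also have "\<dots> = - (?N * d)" using E0 by (simp add: d_def \<psi>_def field_simps)
    also have "\<dots> \<le> - ((1 - card K * \<delta>) * card F * d)"
      using mult_right_mono[OF card_folner_core[OF F K(2,3)] d] by simp
    finally have "ln (admissible_sum G f A' F) \<le> card F * (ln c - (1 - card K * \<delta>) * d)"
      by (simp add: algebra_simps)
    also have "\<dots> < card F * r"
      using F0 \<delta>d by (intro mult_strict_left_mono) (auto simp: d_def algebra_simps)
    finally have "ln (admissible_sum G f A' F) / card F < r" using F0 by (simp add: field_simps)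
    then show ?thesis
      using r(2) local_permanent_eq_ln[OF is_group f False A'(1) fin(3) F'(1)]
      by (simp add: less_trans[of _ "ereal r"])
  qed
  then show ?thesis
    unfolding eventually_folner_filter[OF is_group] using K(1) \<delta> by blast
qed

text \<open>The infimum bounds all local values from below, and by the preceding lemma they
  eventually drop below anything larger. Amenability makes the filter proper, which gives uniqueness
  of the limit.\<close>

theorem per_eq_INF:
  assumes G: "group G" "amenable G" and f: "f \<in> nonneg_group_ring G"
    and A: "Poly_Mapping.keys f \<subseteq> A" "A \<in> nonempty_finite_subsets G"
  shows "per G f = (INF E \<in> nonempty_finite_subsets G. local_permanent G f A E)"
proof -
  interpret group G by fact
  let ?I = "\<lambda>A. INF E \<in> nonempty_finite_subsets G. local_permanent G f A E"
  have nontrivial: "folner_filter G \<noteq> bot" using G folner_filter_neq_bot_iff by blast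
  have ev: "eventually (\<lambda>F. F \<in> nonempty_finite_subsets G) (folner_filter G)"
    unfolding eventually_folner_filter[OF is_group]
    using A(2) by (intro bexI[of _ A] exI[of _ 1]) (auto simp: folner_sets_def)
  have upper: "eventually (\<lambda>F. local_permanent G f C F < u) (folner_filter G)"
    if "Poly_Mapping.keys f \<subseteq> B" "B \<in> nonempty_finite_subsets G"
      "Poly_Mapping.keys f \<subseteq> C" "C \<in> nonempty_finite_subsets G" "?I B < u" for B C u
    using that eventually_local_permanent_less[OF f] unfolding INF_less_iff by blast
  have INF_le: "?I C \<le> ?I B"
    if BC: "Poly_Mapping.keys f \<subseteq> B" "B \<in> nonempty_finite_subsets G"
      "Poly_Mapping.keys f \<subseteq> C" "C \<in> nonempty_finite_subsets G" for B C
  proof (rule dense_ge)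
    fix u assume "?I B < u"
    \<comment> \<open>A proper filter provides an actual \<open>F\<close> whose value for
      \<open>C\<close> is below \<open>u\<close>; exchanging \<open>B\<close> and \<open>C\<close>
      then shows that the infimum does not depend on the finite set.\<close>
    from eventually_happens'[OF nontrivial eventually_conj[OF ev upper[OF BC this]]]
    obtain F where "F \<in> nonempty_finite_subsets G" "local_permanent G f C F < u" by blast
    then show "?I C \<le> u" by (intro INF_lower2[of F]) (auto intro: less_imp_le)
  qed
  have lim: "(local_permanent G f C \<longlongrightarrow> ?I A) (folner_filter G)"
    if C: "Poly_Mapping.keys f \<subseteq> C" "C \<in> nonempty_finite_subsets G" for C
  proof (rule order_tendstoI)
    fix l assume "l < ?I A"
    then have "l < ?I C" using INF_le[OF C A] by (rule less_le_trans)
    then have "l < local_permanent G f C F" if "F \<in> nonempty_finite_subsets G" for F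
      using INF_lower[OF that] by (rule less_le_trans)
    then show "eventually (\<lambda>F. l < local_permanent G f C F) (folner_filter G)"
      by (rule eventually_mono[OF ev])
  qed (rule upper[OF A C])
  show ?thesis
    unfolding per_def
  proof (rule the_equality)
    fix L assume "\<forall>A\<in>nonempty_finite_subsets G. Poly_Mapping.keys f \<subseteq> A \<longrightarrow>
      (local_permanent G f A \<longlongrightarrow> L) (folner_filter G)"
    then have "(local_permanent G f A \<longlongrightarrow> L) (folner_filter G)" using A by blast
    then show "L = ?I A" using lim[OF A] by (rule tendsto_unique[OF nontrivial])
  qed (use lim in blast)
qed

section \<open>Comparison with quotients\<close>

lemma log_ereal_mono: "0 \<le> a \<Longrightarrow> a \<le> b \<Longrightarrow> log_ereal a \<le> log_ereal b"
  by (auto simp: log_ereal_def)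

lemma nonneg_group_ring_pushforward:
  assumes "group G" "group H" "\<phi> \<in> hom G H" and f: "f \<in> nonneg_group_ring G"
  shows "pushforward \<phi> f \<in> nonneg_group_ring H"
proof -
  have "pushforward \<phi> f \<in> carrier (group_ring H)"
    using ring_hom_closed[OF pushforward_ring_hom[OF assms(1-3)]] f
    by (simp add: nonneg_group_ring_def)
  then show ?thesis
    using nonneg_group_ring_lookup[OF f]
    by (auto simp: nonneg_group_ring_def lookup_pushforward intro!: sum_nonneg)
qed

lemma lookup_pushforward_inj:
  assumes "Poly_Mapping.keys f \<subseteq> A" "inj_on \<phi> A" "a \<in> A"
  shows "Poly_Mapping.lookup (pushforward \<phi> f) (\<phi> a) = Poly_Mapping.lookup f a"
proof -
  have "{s \<in> Poly_Mapping.keys f. \<phi> s = \<phi> a} = (if a \<in> Poly_Mapping.keys f then {a} else {})"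
    using assms by (auto dest: inj_onD)
  then show ?thesis by (simp add: lookup_pushforward in_keys_iff)
qed

lemma keys_pushforward: "Poly_Mapping.keys (pushforward \<phi> f) \<subseteq> \<phi> ` Poly_Mapping.keys f"
  unfolding pushforward_def by (rule order_trans[OF keys_sum]) auto

text \<open>The infimum for \<open>H\<close> is tested at the image of \<open>E\<close>. Injectivity
  on \<open>A\<close> preserves the coefficients, on \<open>E\<close> the averaging factor, and on
  \<open>E\<close> together with \<open>E <#> A\<close> it allows the transfer of admissible
  choices.\<close>

lemma per_pushforward_le:
  assumes GH: "group G" "group H" "\<phi> \<in> hom G H" and H: "amenable H"
    and f: "f \<in> nonneg_group_ring G"
    and A: "Poly_Mapping.keys f \<subseteq> A" "A \<in> nonempty_finite_subsets G"
    and E: "E \<in> nonempty_finite_subsets G"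
    and inj: "inj_on \<phi> (A \<union> E \<union> (E <#>\<^bsub>G\<^esub> A))"
  shows "per H (pushforward \<phi> f) \<le> local_permanent G f A E"
proof -
  have fin: "finite A" "A \<subseteq> carrier G" "A \<noteq> {}" "finite E" "E \<subseteq> carrier G" "E \<noteq> {}"
    using A(2) E by (auto simp: nonempty_finite_subsets_def)
  have img: "\<phi> ` B \<in> nonempty_finite_subsets H" if "B \<in> nonempty_finite_subsets G" for B
    using that GH(3) by (auto simp: nonempty_finite_subsets_def hom_def)
  have injs: "inj_on \<phi> A" "inj_on \<phi> E" "inj_on \<phi> (E \<union> (E <#>\<^bsub>G\<^esub> A))"
    using inj by (auto intro: inj_on_subset)
  have f': "pushforward \<phi> f \<in> nonneg_group_ring H" by (rule nonneg_group_ring_pushforward[OF GH f])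
  have "Poly_Mapping.keys (pushforward \<phi> f) \<subseteq> \<phi> ` A" using keys_pushforward A(1) by fast
  from per_eq_INF[OF GH(2) H f' this img[OF A(2)]]
  have "per H (pushforward \<phi> f) \<le> local_permanent H (pushforward \<phi> f) (\<phi> ` A) (\<phi> ` E)"
    by (simp only: INF_lower[OF img[OF E]])
  also have "\<dots> \<le> local_permanent G f A E"
  proof -
    have "admissible_sum H (pushforward \<phi> f) (\<phi> ` A) (\<phi> ` E) \<le> admissible_sum G f A E"
    proof (rule admissible_sum_transfer[OF GH(1,2)])
      show "\<phi> ` E \<subseteq> carrier H" "\<phi> ` A \<subseteq> carrier H"
        using img[OF E] img[OF A(2)] by (simp_all add: nonempty_finite_subsets_def)
      show "\<phi> (s \<otimes>\<^bsub>G\<^esub> a) = \<phi> s \<otimes>\<^bsub>H\<^esub> \<phi> a" if "s \<in> E" "a \<in> A" for s a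
        using that fin hom_mult[OF GH(3)] by blast
    qed (use fin injs f lookup_pushforward_inj[OF A(1)] in auto)
    moreover have "0 \<le> admissible_sum H (pushforward \<phi> f) (\<phi> ` A) (\<phi> ` E)"
      unfolding admissible_sum_def by (intro sum_nonneg prod_nonneg nonneg_group_ring_lookup[OF f'])
    ultimately show ?thesis
      unfolding local_permanent_def card_image[OF injs(2)] admissible_sum_def[symmetric]
      by (intro ereal_mult_left_mono log_ereal_mono) auto
  qed
  finally show ?thesis .
qed

text \<open>A nontrivial element lies in only finitely many \<open>\<Delta> n\<close>, and a
  collision of cosets puts one of the finitely many nontrivial quotients
  \<open>s \<otimes> inv t\<close> of points of \<open>B\<close> into
  \<open>\<Delta> n\<close>.\<close>

lemma (in group) eventually_inj_on_cosets:
  assumes \<Delta>: "\<And>n. \<Delta> n \<lhd> G"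
    and int: "(\<Inter>m. \<Union>n\<in>{m..}. \<Delta> n) = {\<one>\<^bsub>G\<^esub>}"
    and B: "finite B" "B \<subseteq> carrier G"
  shows "eventually (\<lambda>n. inj_on (\<lambda>s. \<Delta> n #>\<^bsub>G\<^esub> s) B) sequentially"
proof -
  have ev: "eventually (\<lambda>n. g \<notin> \<Delta> n) sequentially" if "g \<noteq> \<one>" for g
  proof -
    have "g \<notin> (\<Inter>m. \<Union>n\<in>{m..}. \<Delta> n)" using that int by simp
    then obtain m where "g \<notin> (\<Union>n\<in>{m..}. \<Delta> n)" by blast
    then have "\<forall>n\<ge>m. g \<notin> \<Delta> n" by blast
    then show ?thesis unfolding eventually_sequentially by blast
  qed
  have "eventually (\<lambda>n. \<forall>g \<in> (\<lambda>(s, t). s \<otimes> inv t) ` (B \<times> B) - {\<one>}. g \<notin> \<Delta> n) sequentially"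
  proof (rule eventually_ball_finite)
    show "finite ((\<lambda>(s, t). s \<otimes> inv t) ` (B \<times> B) - {\<one>})" using B(1) by simp
  qed (use ev in blast)
  then show ?thesis
  proof eventually_elim
    case (elim n)
    have sub: "subgroup (\<Delta> n) G" by (rule normal_imp_subgroup[OF \<Delta>])
    show ?case
    proof (rule inj_onI)
      fix s t assume st: "s \<in> B" "t \<in> B" "\<Delta> n #> s = \<Delta> n #> t"
      then have G: "s \<in> carrier G" "t \<in> carrier G" using B by auto
      have "s \<otimes> inv t \<in> \<Delta> n"
        by (rule coset_join1[OF coset_mult_inv2[OF st(3) G subgroup.subset[OF sub]]
          m_closed[OF G(1) inv_closed[OF G(2)]] sub])
      moreover have "s \<otimes> inv t \<in> (\<lambda>(s, t). s \<otimes> inv t) ` (B \<times> B)"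
        using st by (intro image_eqI[of _ _ "(s, t)"]) simp_all
      ultimately have "s \<otimes> inv t = \<one>" using elim by blast
      then show "s = t" using inv_equality[OF _ inv_closed[OF G(2)] G(1)] inv_inv[OF G(2)] by metis
    qed
  qed
qed

theorem proposition6p1:
  fixes \<Gamma> :: "('a, 'b) monoid_scheme" and \<Delta> :: "nat \<Rightarrow> 'a set" and f :: "'a \<Rightarrow>\<^sub>0 real"
  assumes "group \<Gamma>" and "countable (carrier \<Gamma>)" and "amenable \<Gamma>" and "residually_finite \<Gamma>"
    and "\<And>n. \<Delta> n \<lhd> \<Gamma>" and "\<And>n. finite (carrier (\<Gamma> Mod \<Delta> n))"
    and "(\<Inter>m. \<Union>n\<in>{m..}. \<Delta> n) = {\<one>\<^bsub>\<Gamma>\<^esub>}"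
    and "f \<in> nonneg_group_ring \<Gamma>"
  shows "limsup (\<lambda>n. per (\<Gamma> Mod \<Delta> n) (quotient_projection \<Gamma> (\<Delta> n) f)) \<le> per \<Gamma> f"
proof -
  interpret group \<Gamma> by fact
  \<comment> \<open>The identity is added so that \<open>A\<close> is nonempty even for
    \<open>f = 0\<close>.\<close>
  define A where "A = insert \<one>\<^bsub>\<Gamma>\<^esub> (Poly_Mapping.keys f)"
  have A: "Poly_Mapping.keys f \<subseteq> A" "A \<in> nonempty_finite_subsets \<Gamma>"
    using nonneg_group_ring_keys[OF assms(8)] by (auto simp: A_def nonempty_finite_subsets_def)
  have quotient: "group (\<Gamma> Mod \<Delta> n)" "amenable (\<Gamma> Mod \<Delta> n)" for n
  proof -
    show Q: "group (\<Gamma> Mod \<Delta> n)" by (rule normal.factorgroup_is_group[OF assms(5)])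
    show "amenable (\<Gamma> Mod \<Delta> n)"
      \<comment> \<open>The Folner filter of a finite group is principal at the whole group, hence
        proper.\<close>
      using folner_filter_neq_bot_iff[OF Q] folner_filter_finite[OF Q assms(6)]
      by (simp add: principal_eq_bot_iff)
  qed
  have "limsup (\<lambda>n. per (\<Gamma> Mod \<Delta> n) (quotient_projection \<Gamma> (\<Delta> n) f)) \<le> local_permanent \<Gamma> f A E"
    if E: "E \<in> nonempty_finite_subsets \<Gamma>" for E
  proof (rule Limsup_bounded)
    have "finite (A \<union> E \<union> (E <#>\<^bsub>\<Gamma>\<^esub> A))" "A \<union> E \<union> (E <#>\<^bsub>\<Gamma>\<^esub> A) \<subseteq> carrier \<Gamma>"
      using A(2) E set_mult_closed[of E A] by (auto simp: nonempty_finite_subsets_def set_mult_def)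
    from eventually_inj_on_cosets[OF assms(5,7) this]
    show "eventually (\<lambda>n. per (\<Gamma> Mod \<Delta> n) (quotient_projection \<Gamma> (\<Delta> n) f) \<le> local_permanent \<Gamma> f A E)
        sequentially"
      unfolding quotient_projection_def
      by eventually_elim
        (rule per_pushforward_le[OF assms(1) quotient(1) normal.r_coset_hom_Mod[OF assms(5)]
          quotient(2) assms(8) A E])
  qed
  \<comment> \<open>The index from which the bound holds depends on \<open>E\<close>, but the limsup
    does not, so the infimum over \<open>E\<close> may be taken afterwards.\<close>
  then show ?thesis
    unfolding per_eq_INF[OF assms(1,3,8) A] by (rule INF_greatest)
qed

end
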